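(* Let $A$ be a linear, closed, densely defined, unbounded operator in a Hilbert space $H$, and let $\alpha>0$ be a constant. Put $T:=A^*A$ and $T_\alpha:=T+\alpha I$. Then the operator $S:=T_\alpha^{-1}A^*$ with domain $D(A^* )$ admits a unique closed extension $\overline{S}$ defined on all of $H$, and $\|\overline{S}\|\le \frac{1}{2\sqrt{\alpha}}$.
   Context: $D(\cdot)$ denotes the domain of an operator, $A^*$ is the adjoint of $A$, and $I$ is the identity operator on $H$. Since $A$ is closed and densely defined, $A^*$ is closed and densely defined, $T=A^*A$ (with its natural domain $\{u\in D(A): Au\in D(A^* )\}$) is a nonnegative selfadjoint densely defined operator, and for $\alpha>0$ the operator $T_\alpha$ has a bounded inverse defined on all of $H$ with norm at most $1/\alpha$. *)

theory Defs
  imports "HOL-Analysis.Analysis"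
begin

text \<open>
  The scalar field of a Hilbert space: the reals or the complex numbers. By Gelfand--Mazur these are,
  up to isomorphism, the only real normed fields, and \<open>mult_scnj\<close> forces \<open>scnj\<close> to be the
  usual conjugation.
\<close>

class hilbert_scalar = real_normed_field +
  fixes scnj :: "'a \<Rightarrow> 'a"
  assumes scnj_add: "scnj (x + y) = scnj x + scnj y"
    and scnj_mult: "scnj (x * y) = scnj x * scnj y"
    and scnj_scnj: "scnj (scnj x) = x"
    and mult_scnj: "x * scnj x = (norm x)\<^sup>2 *\<^sub>R 1"

instantiation real :: hilbert_scalar
begin
definition scnj_real :: "real \<Rightarrow> real" where "scnj_real x = x"
instance by standard (simp_all add: scnj_real_def power2_eq_square)
end

instantiation complex :: hilbert_scalar
begin
definition scnj_complex :: "complex \<Rightarrow> complex" where "scnj_complex x = cnj x"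
instance by standard (simp_all add: scnj_complex_def complex_norm_square scaleR_conv_of_real flip: of_real_power)
end

text \<open>
  Completeness, the norm and the topology come from the class \<open>banach\<close>; \<open>ip_self\<close> says that the
  norm is the one induced by the inner product, which also makes the latter positive definite.
\<close>

locale hilbert_space = vector_space smul
  for smul :: "'k::hilbert_scalar \<Rightarrow> 'a::banach \<Rightarrow> 'a" +
  fixes ip :: "'a \<Rightarrow> 'a \<Rightarrow> 'k"
  assumes smul_of_real: "smul (of_real r) x = r *\<^sub>R x"
    and ip_add_left: "ip (x + y) z = ip x z + ip y z"
    and ip_smul_left: "ip (smul c x) y = c * ip x y"
    and ip_commute: "ip x y = scnj (ip y x)"
    and ip_self: "ip x x = of_real ((norm x)\<^sup>2)"

lemma hilbert_space_real:
  "hilbert_space scaleR (inner :: 'a::{real_inner,banach} \<Rightarrow> 'a \<Rightarrow> real)"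
  by unfold_locales
    (simp_all add: algebra_simps inner_commute scnj_real_def power2_norm_eq_inner)

lemma hilbert_space_complex: "hilbert_space (*) (\<lambda>x y :: complex. x * cnj y)"
  by unfold_locales
    (simp_all add: algebra_simps scnj_complex_def complex_norm_square scaleR_conv_of_real flip: of_real_power)

text \<open>
  An operator, defined on a subspace of the Hilbert space, is identified with its graph. Thus
  \<open>Domain A\<close> is \<open>D(A)\<close>, the product \<open>B A\<close> with its natural domain is \<open>A O B\<close>, the inverse of \<open>A\<close>
  is \<open>A\<inverse>\<close>, an extension is a superset, and \<open>A\<close> is a closed operator iff \<open>closed A\<close> holds in the
  product topology.
\<close>

definition linear_operator ::
  "('k::hilbert_scalar \<Rightarrow> 'a::banach \<Rightarrow> 'a) \<Rightarrow> ('a \<times> 'a) set \<Rightarrow> bool" where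
  "linear_operator smul A \<longleftrightarrow> single_valued A \<and> (0, 0) \<in> A \<and>
     (\<forall>u v u' v'. (u, v) \<in> A \<longrightarrow> (u', v') \<in> A \<longrightarrow> (u + u', v + v') \<in> A) \<and>
     (\<forall>c u v. (u, v) \<in> A \<longrightarrow> (smul c u, smul c v) \<in> A)"

definition closed_operator ::
  "('k::hilbert_scalar \<Rightarrow> 'a::banach \<Rightarrow> 'a) \<Rightarrow> ('a \<times> 'a) set \<Rightarrow> bool" where
  "closed_operator smul A \<longleftrightarrow> linear_operator smul A \<and> closed A"

definition densely_defined :: "('a::banach \<times> 'a) set \<Rightarrow> bool" where
  "densely_defined A \<longleftrightarrow> closure (Domain A) = UNIV"

text \<open>The norm is \<open>\<infinity>\<close> exactly when the operator is unbounded.\<close>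

definition op_norm :: "('a::banach \<times> 'a) set \<Rightarrow> ereal" where
  "op_norm A = (SUP (u, v) \<in> {(u, v) \<in> A. norm u \<le> 1}. ereal (norm v))"

definition unbounded_operator :: "('a::banach \<times> 'a) set \<Rightarrow> bool" where
  "unbounded_operator A \<longleftrightarrow> op_norm A = \<infinity>"

text \<open>\<open>(v, w)\<close> is in the adjoint iff \<open>\<langle>Au, v\<rangle> = \<langle>u, w\<rangle>\<close> for all \<open>u\<close> in \<open>D(A)\<close>; when \<open>A\<close> is
  densely defined, \<open>v\<close> determines \<open>w\<close>.\<close>

definition op_adjoint ::
  "('a::banach \<Rightarrow> 'a \<Rightarrow> 'k::hilbert_scalar) \<Rightarrow> ('a \<times> 'a) set \<Rightarrow> ('a \<times> 'a) set" where
  "op_adjoint ip A = {(v, w). \<forall>(u, z) \<in> A. ip z v = ip u w}"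

definition op_shift :: "('a::banach \<times> 'a) set \<Rightarrow> real \<Rightarrow> ('a \<times> 'a) set" where
  "op_shift T \<alpha> = {(u, v + \<alpha> *\<^sub>R u) | u v. (u, v) \<in> T}"

end

theory Submission imports Defs begin

text \<open>
  For \<open>f\<close> in \<open>H\<close> the functional \<open>\<parallel>Au - f\<parallel>\<^sup>2 + \<alpha>\<parallel>u\<parallel>\<^sup>2\<close> has a minimiser \<open>u\<close> on \<open>D(A)\<close>, because the
  graph of \<open>A\<close> is closed, and the Euler--Lagrange equation says that \<open>f - Au\<close> is in \<open>D(A\<^sup>*)\<close> with
  \<open>A\<^sup>*(f - Au) = \<alpha>u\<close>. This relation between \<open>f\<close> and \<open>u\<close> is the extension of \<open>S\<close>: if \<open>f\<close> is in
  \<open>D(A\<^sup>*)\<close>, it reads \<open>A\<^sup>*f = A\<^sup>*Au + \<alpha>u\<close>. Pairing it with \<open>u\<close> gives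
  \<open>\<parallel>Au\<parallel>\<^sup>2 + \<alpha>\<parallel>u\<parallel>\<^sup>2 = Re \<langle>Au, f\<rangle> \<le> \<parallel>Au\<parallel> \<parallel>f\<parallel>\<close>, whence \<open>2 \<surd>\<alpha> \<parallel>u\<parallel> \<le> \<parallel>f\<parallel>\<close> by AM-GM. The extension is
  therefore bounded and everywhere defined, and it is the only closed one because \<open>D(A\<^sup>*)\<close> is dense.
\<close>

section \<open>Least-norm points and first-order conditions\<close>

text \<open>A minimising sequence is Cauchy by the parallelogram law. The law is a hypothesis on the
  norm, so that the lemma serves both H and the product H x H in which graphs live.\<close>

lemma closed_convex_least_norm:
  fixes M :: "'b::banach set"
  assumes par: "\<And>x y :: 'b. (norm (x + y))\<^sup>2 + (norm (x - y))\<^sup>2 = 2 * (norm x)\<^sup>2 + 2 * (norm y)\<^sup>2"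
    and "closed M" "convex M" "M \<noteq> {}"
  shows "\<exists>m\<in>M. \<forall>y\<in>M. norm m \<le> norm y"
proof -
  define d where "d = (INF y\<in>M. (norm y)\<^sup>2)"
  have bdd: "bdd_below ((\<lambda>y. (norm y)\<^sup>2) ` M)"
    by (rule bdd_belowI[of _ 0]) auto
  have d_le: "d \<le> (norm y)\<^sup>2" if "y \<in> M" for y
    unfolding d_def by (rule cINF_lower[OF bdd that])
  have "\<exists>y\<in>M. (norm y)\<^sup>2 < d + inverse (real (Suc n))" for n
  proof -
    have "Inf ((\<lambda>y. (norm y)\<^sup>2) ` M) < d + inverse (real (Suc n))"
      unfolding d_def by simp
    then show ?thesis
      using cInf_lessD[of "(\<lambda>y. (norm y)\<^sup>2) ` M"] \<open>M \<noteq> {}\<close> by auto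
  qed
  then obtain x where xM: "\<And>n. x n \<in> M"
    and x_less: "\<And>n. (norm (x n))\<^sup>2 < d + inverse (real (Suc n))"
    by metis
  have x_diff: "(norm (x m - x n))\<^sup>2 \<le> 2 * inverse (real (Suc m)) + 2 * inverse (real (Suc n))" for m n
  proof -
    \<comment> \<open>The midpoint has squared norm at least \<open>d\<close>, so the parallelogram
      law cancels \<open>4 * d\<close> and leaves only the two error terms.\<close>
    have "(1/2) *\<^sub>R x m + (1/2) *\<^sub>R x n \<in> M"
      using \<open>convex M\<close> xM by (auto simp: convex_def)
    then have "d \<le> (norm ((1/2) *\<^sub>R (x m + x n)))\<^sup>2"
      using d_le by (simp add: scaleR_add_right)
    then have "4 * d \<le> (norm (x m + x n))\<^sup>2"
      by (simp add: power_divide)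
    then show ?thesis
      using par[of "x m" "x n"] x_less[of m] x_less[of n] by linarith
  qed
  have "Cauchy x"
  proof (rule metric_CauchyI)
    fix e :: real
    assume "e > 0"
    \<comment> \<open>Each of the two terms in \<open>x_diff\<close> is then below half of
      \<open>e\<close> squared.\<close>
    then obtain N where N: "inverse (real (Suc N)) < e\<^sup>2 / 4"
      using reals_Archimedean[of "e\<^sup>2 / 4"] by auto
    have "dist (x m) (x n) < e" if "m \<ge> N" "n \<ge> N" for m n
    proof -
      have "inverse (real (Suc m)) \<le> inverse (real (Suc N))"
        "inverse (real (Suc n)) \<le> inverse (real (Suc N))"
        using that by (auto intro!: le_imp_inverse_le)
      then have "(norm (x m - x n))\<^sup>2 < e\<^sup>2"
        using x_diff[of m n] N by linarith
      then show ?thesis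
        using \<open>e > 0\<close> by (simp add: dist_norm power_less_imp_less_base)
    qed
    then show "\<exists>N. \<forall>m\<ge>N. \<forall>n\<ge>N. dist (x m) (x n) < e"
      by blast
  qed
  then obtain l where l: "x \<longlonglongrightarrow> l"
    using Cauchy_convergent convergent_def by blast
  have "l \<in> M"
    using closed_sequentially[OF \<open>closed M\<close> _ l] xM by blast
  have "(norm l)\<^sup>2 \<le> d"
  proof (rule LIMSEQ_le)
    show "(\<lambda>n. (norm (x n))\<^sup>2) \<longlonglongrightarrow> (norm l)\<^sup>2"
      by (intro tendsto_intros l)
    show "(\<lambda>n. d + inverse (real (Suc n))) \<longlonglongrightarrow> d"
      using tendsto_add[OF tendsto_const LIMSEQ_inverse_real_of_nat, of d] by simp
    show "\<exists>N. \<forall>n\<ge>N. (norm (x n))\<^sup>2 \<le> d + inverse (real (Suc n))"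
      using x_less less_imp_le by blast
  qed
  then have "norm l \<le> norm y" if "y \<in> M" for y
    using d_le[OF that] by (meson norm_ge_zero order_trans power2_le_imp_le)
  then show ?thesis
    using \<open>l \<in> M\<close> by blast
qed

text \<open>This is the vanishing of the first variation: at a minimiser of a quadratic functional,
  the increment along a line has this form in \<open>t\<close>.\<close>

lemma quadratic_nonneg_imp_linear_coeff_zero:
  fixes b c :: real
  assumes "\<And>t. 0 \<le> 2 * t * b + t\<^sup>2 * c"
  shows "b = 0"
proof (rule ccontr)
  assume "b \<noteq> 0"
  \<comment> \<open>Any \<open>k\<close> that is positive and exceeds \<open>c\<close> works: at
    \<open>t = - b / k\<close> the linear term then outweighs the quadratic one.\<close>
  define k where "k = \<bar>c\<bar> + 1"
  have "k > 0" "c < k"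
    by (auto simp: k_def)
  have "0 \<le> 2 * (- b / k) * b + (- b / k)\<^sup>2 * c"
    by (rule assms)
  also have "\<dots> = (b / k)\<^sup>2 * (c - 2 * k)"
    using \<open>k > 0\<close> by (simp add: field_simps power2_eq_square)
  also have "\<dots> < 0"
    using \<open>b \<noteq> 0\<close> \<open>k > 0\<close> \<open>c < k\<close> by (intro mult_pos_neg) auto
  finally show False
    by simp
qed

lemma scnj_of_real: "scnj (of_real r :: 'k::hilbert_scalar) = of_real r"
proof (cases "r = 0")
  case True
  then show ?thesis
    using scnj_add[of "0::'k" 0] by simp
next
  case False
  have "(of_real r :: 'k) * scnj (of_real r) = of_real r * of_real r"
    by (simp add: mult_scnj power2_eq_square scaleR_conv_of_real)
  then show ?thesis
    using False by simp
qed

lemma scnj_minus: "scnj (- x) = - scnj (x :: 'k::hilbert_scalar)"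
  using scnj_mult[of "of_real (-1)" x] by (simp only: scnj_of_real) simp

lemma subspace_closure:
  fixes M :: "'b::real_normed_vector set"
  assumes "subspace M"
  shows "subspace (closure M)"
proof (rule subspaceI)
  show "0 \<in> closure M"
    using subspace_0[OF assms] closure_subset by blast
next
  fix x y
  assume "x \<in> closure M" "y \<in> closure M"
  then obtain f g where "\<And>n. f n \<in> M" "f \<longlonglongrightarrow> x" "\<And>n. g n \<in> M" "g \<longlonglongrightarrow> y"
    unfolding closure_sequential by blast
  then have "\<And>n. f n + g n \<in> M" "(\<lambda>n. f n + g n) \<longlonglongrightarrow> x + y"
    by (auto intro: subspace_add[OF assms] tendsto_add)
  then show "x + y \<in> closure M"
    unfolding closure_sequential by (intro exI[of _ "\<lambda>n. f n + g n"]) auto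
next
  fix c x
  assume "x \<in> closure M"
  then obtain f where "\<And>n. f n \<in> M" "f \<longlonglongrightarrow> x"
    unfolding closure_sequential by blast
  then have "\<And>n. c *\<^sub>R f n \<in> M" "(\<lambda>n. c *\<^sub>R f n) \<longlonglongrightarrow> c *\<^sub>R x"
    by (auto intro: subspace_scale[OF assms] tendsto_scaleR)
  then show "c *\<^sub>R x \<in> closure M"
    unfolding closure_sequential by (intro exI[of _ "\<lambda>n. c *\<^sub>R f n"]) auto
qed

section \<open>The real inner product and orthogonality\<close>

context hilbert_space
begin

text \<open>The real part of \<open>ip\<close>, defined by polarisation, since \<open>hilbert_scalar\<close> provides no real part.\<close>

definition rip :: "'a \<Rightarrow> 'a \<Rightarrow> real" where
  "rip x y = ((norm (x + y))\<^sup>2 - (norm x)\<^sup>2 - (norm y)\<^sup>2) / 2"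

lemma ip_add_right: "ip x (y + z) = ip x y + ip x z"
  by (metis ip_commute ip_add_left scnj_add)

lemma ip_smul_right: "ip x (smul c y) = scnj c * ip x y"
  by (metis ip_commute ip_smul_left scnj_mult)

lemma of_real_rip: "of_real (2 * rip x y) = ip x y + ip y x"
proof -
  have "of_real (2 * rip x y) = ip (x + y) (x + y) - ip x x - ip y y"
    by (simp add: rip_def ip_self)
  then show ?thesis
    by (simp add: ip_add_left ip_add_right)
qed

lemma norm_add_sq: "(norm (x + y))\<^sup>2 = (norm x)\<^sup>2 + 2 * rip x y + (norm y)\<^sup>2"
  by (simp add: rip_def field_simps)

lemma rip_commute: "rip x y = rip y x"
  by (simp add: rip_def add.commute)

text \<open>Additivity is inherited from \<open>ip\<close>: the two sides are compared inside the
  scalar field, where \<open>of_real\<close> is injective.\<close>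

lemma rip_add_left: "rip (x + y) z = rip x z + rip y z"
proof -
  have "(of_real (2 * rip (x + y) z) :: 'k) = of_real (2 * (rip x z + rip y z))"
    unfolding of_real_rip distrib_left of_real_add by (simp add: ip_add_left ip_add_right)
  then show ?thesis
    unfolding of_real_eq_iff by simp
qed

lemma rip_scaleR_left: "rip (r *\<^sub>R x) z = r * rip x z"
proof -
  have "(of_real (2 * rip (r *\<^sub>R x) z) :: 'k) = of_real r * of_real (2 * rip x z)"
    unfolding of_real_rip
    by (simp flip: smul_of_real add: ip_smul_left ip_smul_right scnj_of_real distrib_left)
  then have "(of_real (2 * rip (r *\<^sub>R x) z) :: 'k) = of_real (r * (2 * rip x z))"
    by simp
  then show ?thesis
    unfolding of_real_eq_iff by simp
qed

lemma rip_add_right: "rip z (x + y) = rip z x + rip z y"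
  by (metis rip_add_left rip_commute)

lemma rip_scaleR_right: "rip z (r *\<^sub>R x) = r * rip z x"
  by (metis rip_scaleR_left rip_commute)

lemma rip_minus_left: "rip (- x) z = - rip x z"
  using rip_scaleR_left[of "-1"] by simp

lemma rip_diff_left: "rip (x - y) z = rip x z - rip y z"
  using rip_add_left[of x "- y" z] by (simp add: rip_minus_left)

lemma rip_diff_right: "rip z (x - y) = rip z x - rip z y"
  by (metis rip_diff_left rip_commute)

lemma rip_self: "rip x x = (norm x)\<^sup>2"
proof -
  have "norm (x + x) = 2 * norm x"
    by (simp flip: scaleR_2)
  then show ?thesis
    by (simp add: rip_def power_mult_distrib)
qed

text \<open>Cauchy-Schwarz is the squared triangle inequality here, since \<open>rip\<close> is
  built from the norm.\<close>

lemma rip_le_norm: "rip x y \<le> norm x * norm y"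
proof -
  have "(norm (x + y))\<^sup>2 \<le> (norm x + norm y)\<^sup>2"
    by (intro power_mono norm_triangle_ineq) simp
  then show ?thesis
    by (simp add: rip_def power2_sum)
qed

lemma parallelogram: "(norm (x + y))\<^sup>2 + (norm (x - y))\<^sup>2 = 2 * (norm x)\<^sup>2 + 2 * (norm y)\<^sup>2"
  for x y :: 'a
  by (simp flip: rip_self
      add: rip_add_left rip_add_right rip_diff_left rip_diff_right)

lemma norm_add_scaleR_sq: "(norm (x + t *\<^sub>R y))\<^sup>2 = (norm x)\<^sup>2 + 2 * t * rip x y + t\<^sup>2 * (norm y)\<^sup>2"
  by (simp add: norm_add_sq rip_scaleR_right power_mult_distrib)

text \<open>By the projection argument, the difference between any \<open>f\<close> and its nearest
  point in \<open>closure M\<close> is orthogonal to \<open>M\<close>, hence zero.\<close>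

lemma dense_if_orthogonal_zero:
  fixes M :: "'a set"
  assumes "Real_Vector_Spaces.subspace M" and orth: "\<And>p. (\<And>y. y \<in> M \<Longrightarrow> rip p y = 0) \<Longrightarrow> p = 0"
  shows "closure M = UNIV"
proof -
  have sub: "Real_Vector_Spaces.subspace (closure M)"
    using \<open>Real_Vector_Spaces.subspace M\<close> by (rule subspace_closure)
  have "f \<in> closure M" for f
  proof -
    let ?N = "(\<lambda>y. y - f) ` closure M"
    have "\<exists>m\<in>?N. \<forall>y\<in>?N. norm m \<le> norm y"
    proof (rule closed_convex_least_norm[OF parallelogram])
      show "closed ?N"
        using closed_translation[of "closure M" "- f"] by (simp add: add.commute)
      show "convex ?N"
        using convex_translation[OF subspace_imp_convex[OF sub], of "- f"] by (simp add: add.commute)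
      show "?N \<noteq> {}"
        using real_vector.subspace_0[OF sub] by auto
    qed
    then obtain m where m: "m \<in> closure M"
      and least: "\<And>y. y \<in> closure M \<Longrightarrow> norm (m - f) \<le> norm (y - f)"
      by auto
    have "rip (m - f) y = 0" if "y \<in> M" for y
    proof (rule quadratic_nonneg_imp_linear_coeff_zero)
      fix t :: real
      have "m + t *\<^sub>R y \<in> closure M"
        using m that closure_subset sub by (blast intro: real_vector.subspace_add real_vector.subspace_scale)
      then have "(norm (m - f))\<^sup>2 \<le> (norm (m + t *\<^sub>R y - f))\<^sup>2"
        using least by (intro power_mono) auto
      also have "m + t *\<^sub>R y - f = (m - f) + t *\<^sub>R y"
        by simp
      finally show "0 \<le> 2 * t * rip (m - f) y + t\<^sup>2 * (norm y)\<^sup>2"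
        unfolding norm_add_scaleR_sq by simp
    qed
    then have "m - f = 0"
      by (rule orth)
    then show ?thesis
      using m by simp
  qed
  then show ?thesis
    by blast
qed

section \<open>Adjoints and the real inner product\<close>

lemma of_real_rip_scnj: "of_real (2 * rip x y) = ip x y + scnj (ip x y)"
  using of_real_rip ip_commute[of y x] by simp

lemma linear_operator_subspace:
  assumes "linear_operator smul A"
  shows "Real_Vector_Spaces.subspace A"
  using assms unfolding linear_operator_def real_vector.subspace_def
  by (auto simp: zero_prod_def simp flip: smul_of_real)

text \<open>Variations along real \<open>t\<close> only yield identities for \<open>rip\<close>.
  They give the full adjoint relation because the graph of \<open>A\<close> is stable under all
  scalars.\<close>

lemma op_adjoint_iff_rip:
  assumes "linear_operator smul A"
  shows "(v, w) \<in> op_adjoint ip A \<longleftrightarrow> (\<forall>(u, z)\<in>A. rip z v = rip u w)"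
proof
  assume "(v, w) \<in> op_adjoint ip A"
  then have eq: "ip z v = ip u w" if "(u, z) \<in> A" for u z
    using that by (auto simp: op_adjoint_def)
  have "rip z v = rip u w" if "(u, z) \<in> A" for u z
  proof -
    have "(of_real (2 * rip z v) :: 'k) = of_real (2 * rip u w)"
      unfolding of_real_rip_scnj eq[OF that] ..
    then show ?thesis
      unfolding of_real_eq_iff by simp
  qed
  then show "\<forall>(u, z)\<in>A. rip z v = rip u w"
    by blast
next
  assume rip_eq: "\<forall>(u, z)\<in>A. rip z v = rip u w"
  have "ip z v = ip u w" if uz: "(u, z) \<in> A" for u z
  proof -
    define d where "d = ip z v - ip u w"
    \<comment> \<open>Scaling by \<open>scnj d\<close> turns the discrepancy \<open>d\<close> into
      \<open>scnj d * d\<close>, which is real, so equality of real parts detects it.\<close>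
    have "(smul (scnj d) u, smul (scnj d) z) \<in> A"
      using assms uz by (auto simp: linear_operator_def)
    then have "rip (smul (scnj d) z) v = rip (smul (scnj d) u) w"
      using rip_eq by blast
    then have "scnj d * ip z v + scnj (scnj d * ip z v) = scnj d * ip u w + scnj (scnj d * ip u w)"
      using of_real_rip_scnj[of "smul (scnj d) z" v]
        of_real_rip_scnj[of "smul (scnj d) u" w]
      by (simp add: ip_smul_left)
    then have "scnj d * (ip z v - ip u w) + d * (scnj (ip z v) - scnj (ip u w)) = 0"
      by (simp add: scnj_mult scnj_scnj algebra_simps)
    moreover have "scnj (ip z v) - scnj (ip u w) = scnj d"
      using scnj_add[of "ip z v" "- ip u w"] by (simp add: d_def scnj_minus)
    ultimately have "scnj d * d + d * scnj d = 0"
      by (simp only: d_def)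
    then have "2 * (d * scnj d) = 0"
      by (simp add: mult.commute)
    then have "d = 0"
      by (simp add: mult_scnj)
    then show ?thesis
      by (simp add: d_def)
  qed
  then show "(v, w) \<in> op_adjoint ip A"
    by (auto simp: op_adjoint_def)
qed

lemma op_adjoint_add:
  "(v, w) \<in> op_adjoint ip A \<Longrightarrow> (v', w') \<in> op_adjoint ip A \<Longrightarrow> (v + v', w + w') \<in> op_adjoint ip A"
  by (fastforce simp: op_adjoint_def ip_add_right)

lemma op_adjoint_smul:
  "(v, w) \<in> op_adjoint ip A \<Longrightarrow> (smul c v, smul c w) \<in> op_adjoint ip A"
  by (fastforce simp: op_adjoint_def ip_smul_right)

lemma op_adjoint_zero: "(0, 0) \<in> op_adjoint ip A"
  using ip_smul_right[of _ 0 0] ip_add_right[of _ 0 0] by (auto simp: op_adjoint_def)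

lemma op_adjoint_subspace: "Real_Vector_Spaces.subspace (op_adjoint ip A)"
  using op_adjoint_zero op_adjoint_add op_adjoint_smul[of _ _ _ "of_real _"]
  unfolding real_vector.subspace_def by (auto simp: zero_prod_def smul_of_real)

lemma smul_scaleR_commute: "smul c (r *\<^sub>R x) = r *\<^sub>R smul c x"
  by (simp flip: smul_of_real add: mult.commute)

section \<open>The regularised least-squares problem and its solution operator\<close>

text \<open>\<open>(f, u)\<close> is in this relation iff \<open>u\<close> solves the Euler--Lagrange equation of
  \<open>\<parallel>Au - f\<parallel>\<^sup>2 + \<alpha>\<parallel>u\<parallel>\<^sup>2\<close>.\<close>

definition tikhonov :: "('a \<times> 'a) set \<Rightarrow> real \<Rightarrow> ('a \<times> 'a) set" where
  "tikhonov A \<alpha> = {(f, u). \<exists>z. (u, z) \<in> A \<and> (f - z, \<alpha> *\<^sub>R u) \<in> op_adjoint ip A}"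

lemma Domain_tikhonov:
  assumes lin: "linear_operator smul A" and "closed A" and "\<alpha> > 0"
  shows "Domain (tikhonov A \<alpha>) = UNIV"
proof -
  have sub: "Real_Vector_Spaces.subspace A"
    using lin by (rule linear_operator_subspace)
  have "f \<in> Domain (tikhonov A \<alpha>)" for f
  proof -
    let ?g = "\<lambda>(u, z). (sqrt \<alpha> *\<^sub>R u, z - f)"
    let ?h = "\<lambda>(u, z). ((1 / sqrt \<alpha>) *\<^sub>R u, z + f)"
    have norm_g: "(norm (?g (u, z)))\<^sup>2 = \<alpha> * (norm u)\<^sup>2 + (norm (z - f))\<^sup>2" for u z
      using \<open>\<alpha> > 0\<close> by (simp add: norm_Pair power_mult_distrib)
    have img: "?g ` A = ?h -` A"
      using \<open>\<alpha> > 0\<close> by (force simp: image_iff)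
    have "\<exists>m\<in>?g ` A. \<forall>y\<in>?g ` A. norm m \<le> norm y"
    proof (rule closed_convex_least_norm)
      show "(norm (x + y))\<^sup>2 + (norm (x - y))\<^sup>2 = 2 * (norm x)\<^sup>2 + 2 * (norm y)\<^sup>2" for x y :: "'a \<times> 'a"
        using parallelogram[of "fst x" "fst y"] parallelogram[of "snd x" "snd y"]
        by (simp add: norm_prod_def)
      show "closed (?g ` A)"
        unfolding img case_prod_beta
        by (intro closed_vimage \<open>closed A\<close> continuous_intros)
      show "convex (?g ` A)"
      proof -
        have "?g ` A = (\<lambda>y. (0, - f) + y) ` (\<lambda>(u, z). (sqrt \<alpha> *\<^sub>R u, z)) ` A"
          by (auto simp: image_image case_prod_beta)
        moreover have "linear (\<lambda>(u :: 'a, z :: 'a). (sqrt \<alpha> *\<^sub>R u, z))"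
          by (intro linearI) (auto simp: algebra_simps)
        ultimately show ?thesis
          using sub by (simp add: convex_translation convex_linear_image subspace_imp_convex)
      qed
      show "?g ` A \<noteq> {}"
        using real_vector.subspace_0[OF sub] by blast
    qed
    then obtain u z where uz: "(u, z) \<in> A"
      and least: "\<And>h k. (h, k) \<in> A \<Longrightarrow> norm (?g (u, z)) \<le> norm (?g (h, k))"
      by fast
    have "rip k (f - z) = rip h (\<alpha> *\<^sub>R u)" if hk: "(h, k) \<in> A" for h k
    proof -
      \<comment> \<open>This is the first variation at \<open>(u, z)\<close> in the direction
        \<open>(h, k)\<close> of the graph.\<close>
      have "\<alpha> * rip u h + rip (z - f) k = 0"
      proof (rule quadratic_nonneg_imp_linear_coeff_zero)
        fix t :: real
        have "(u + t *\<^sub>R h, z + t *\<^sub>R k) \<in> A"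
          using real_vector.subspace_add[OF sub uz real_vector.subspace_scale[OF sub hk, of t]] by simp
        then have "(norm (?g (u, z)))\<^sup>2 \<le> (norm (?g (u + t *\<^sub>R h, z + t *\<^sub>R k)))\<^sup>2"
          using least by (intro power_mono) auto
        also have "\<dots> = \<alpha> * (norm (u + t *\<^sub>R h))\<^sup>2 + (norm ((z - f) + t *\<^sub>R k))\<^sup>2"
          unfolding norm_g by (simp add: diff_add_eq)
        finally show "0 \<le> 2 * t * (\<alpha> * rip u h + rip (z - f) k)
            + t\<^sup>2 * (\<alpha> * (norm h)\<^sup>2 + (norm k)\<^sup>2)"
          unfolding norm_g norm_add_scaleR_sq by (simp add: distrib_left mult_ac)
      qed
      then show ?thesis
        by (simp add: rip_scaleR_right rip_diff_right rip_diff_left rip_commute)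
    qed
    then have "(f - z, \<alpha> *\<^sub>R u) \<in> op_adjoint ip A"
      unfolding op_adjoint_iff_rip[OF lin] by blast
    then show ?thesis
      using uz by (auto simp: tikhonov_def)
  qed
  then show ?thesis
    by blast
qed

text \<open>The adjoint relation is tested with the pair \<open>(u, z)\<close> itself.\<close>

lemma tikhonov_energy:
  assumes "linear_operator smul A" "(u, z) \<in> A" "(f - z, \<alpha> *\<^sub>R u) \<in> op_adjoint ip A"
  shows "rip z f = (norm z)\<^sup>2 + \<alpha> * (norm u)\<^sup>2"
proof -
  have "rip z (f - z) = rip u (\<alpha> *\<^sub>R u)"
    using assms unfolding op_adjoint_iff_rip[OF assms(1)] by blast
  then show ?thesis
    by (simp add: rip_diff_right rip_scaleR_right rip_self)
qed

lemma tikhonov_bound: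
  assumes "linear_operator smul A" "\<alpha> > 0" "(f, u) \<in> tikhonov A \<alpha>"
  shows "norm u \<le> norm f / (2 * sqrt \<alpha>)"
proof -
  obtain z where "(u, z) \<in> A" "(f - z, \<alpha> *\<^sub>R u) \<in> op_adjoint ip A"
    using assms(3) by (auto simp: tikhonov_def)
  then have energy: "(norm z)\<^sup>2 + \<alpha> * (norm u)\<^sup>2 \<le> norm z * norm f"
    using tikhonov_energy[OF assms(1)] rip_le_norm[of z f] by metis
  have "0 \<le> (norm z - sqrt \<alpha> * norm u)\<^sup>2"
    by simp
  also have "\<dots> = (norm z)\<^sup>2 + \<alpha> * (norm u)\<^sup>2 - norm z * (2 * sqrt \<alpha> * norm u)"
    using \<open>\<alpha> > 0\<close> by (simp add: power2_diff power_mult_distrib)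
  finally have "norm z * (2 * sqrt \<alpha> * norm u) \<le> norm z * norm f"
    using energy by linarith
  \<comment> \<open>The factor \<open>norm z\<close> can be cancelled only if \<open>z\<close> is
    nonzero; otherwise the energy inequality forces \<open>u = 0\<close>.\<close>
  moreover have "u = 0" if "z = 0"
    using energy that \<open>\<alpha> > 0\<close> by (simp add: mult_le_0_iff)
  ultimately have "2 * sqrt \<alpha> * norm u \<le> norm f"
    by (cases "z = 0") auto
  then show ?thesis
    using \<open>\<alpha> > 0\<close> by (simp add: field_simps)
qed

lemma linear_operator_tikhonov:
  assumes lin: "linear_operator smul A" and "\<alpha> > 0"
  shows "linear_operator smul (tikhonov A \<alpha>)"
proof -
  have add: "(f + f', u + u') \<in> tikhonov A \<alpha>"
    if "(f, u) \<in> tikhonov A \<alpha>" "(f', u') \<in> tikhonov A \<alpha>" for f u f' u'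
  proof -
    obtain z z' where "(u, z) \<in> A" "(f - z, \<alpha> *\<^sub>R u) \<in> op_adjoint ip A"
      "(u', z') \<in> A" "(f' - z', \<alpha> *\<^sub>R u') \<in> op_adjoint ip A"
      using \<open>(f, u) \<in> _\<close> \<open>(f', u') \<in> _\<close> by (auto simp: tikhonov_def)
    then have "(u + u', z + z') \<in> A"
      "((f + f') - (z + z'), \<alpha> *\<^sub>R (u + u')) \<in> op_adjoint ip A"
      using lin op_adjoint_add[of "f - z" "\<alpha> *\<^sub>R u" A "f' - z'" "\<alpha> *\<^sub>R u'"]
      by (auto simp: linear_operator_def algebra_simps)
    then show ?thesis
      by (auto simp: tikhonov_def)
  qed
  have smul: "(smul c f, smul c u) \<in> tikhonov A \<alpha>" if fu: "(f, u) \<in> tikhonov A \<alpha>" for c f u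
  proof -
    obtain z where "(u, z) \<in> A" "(f - z, \<alpha> *\<^sub>R u) \<in> op_adjoint ip A"
      using fu by (auto simp: tikhonov_def)
    then have "(smul c u, smul c z) \<in> A"
      "(smul c f - smul c z, \<alpha> *\<^sub>R smul c u) \<in> op_adjoint ip A"
      using lin op_adjoint_smul[of "f - z" "\<alpha> *\<^sub>R u" A c]
      by (auto simp: linear_operator_def scale_right_diff_distrib smul_scaleR_commute)
    then show ?thesis
      by (auto simp: tikhonov_def)
  qed
  have zero: "(0, 0) \<in> tikhonov A \<alpha>"
    using lin op_adjoint_zero by (force simp: tikhonov_def linear_operator_def)
  have "single_valued (tikhonov A \<alpha>)"
  proof (rule single_valuedI)
    fix f u u'
    assume "(f, u) \<in> tikhonov A \<alpha>" "(f, u') \<in> tikhonov A \<alpha>"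
    \<comment> \<open>The difference of two solutions for the same \<open>f\<close> solves the
      problem for the datum 0, where the bound leaves only 0.\<close>
    then have "(f + smul (of_real (-1)) f, u + smul (of_real (-1)) u') \<in> tikhonov A \<alpha>"
      by (intro add smul)
    then have "(0, u - u') \<in> tikhonov A \<alpha>"
      by (simp add: smul_of_real del: of_real_minus)
    then show "u = u'"
      using tikhonov_bound[OF lin \<open>\<alpha> > 0\<close>] by fastforce
  qed
  then show ?thesis
    unfolding linear_operator_def using zero add smul by blast
qed

text \<open>By linearity the bound applies to differences. This continuity yields both closedness of
  \<open>tikhonov\<close> and uniqueness of the extension.\<close>

lemma tikhonov_tendsto:
  assumes lin: "linear_operator smul A" and "\<alpha> > 0"
    and mem: "\<And>n. (f n, u n) \<in> tikhonov A \<alpha>" "(f', u') \<in> tikhonov A \<alpha>" and "f \<longlonglongrightarrow> f'"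
  shows "u \<longlonglongrightarrow> u'"
proof -
  have sub: "Real_Vector_Spaces.subspace (tikhonov A \<alpha>)"
    using linear_operator_tikhonov[OF lin \<open>\<alpha> > 0\<close>] by (rule linear_operator_subspace)
  have "norm (u n - u') \<le> norm (f n - f') / (2 * sqrt \<alpha>)" for n
    using real_vector.subspace_diff[OF sub mem(1)[of n] mem(2)] by (intro tikhonov_bound[OF lin \<open>\<alpha> > 0\<close>]) simp
  moreover have "(\<lambda>n. norm (f n - f') / (2 * sqrt \<alpha>)) \<longlonglongrightarrow> 0"
    using tendsto_norm_zero[OF LIM_zero[OF \<open>f \<longlonglongrightarrow> f'\<close>]] by (rule tendsto_divide_zero)
  ultimately have "(\<lambda>n. u n - u') \<longlonglongrightarrow> 0"
    by (rule Lim_null_comparison[OF always_eventually[OF allI]])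
  then show ?thesis
    by (rule LIM_zero_cancel)
qed

lemma closed_tikhonov:
  assumes lin: "linear_operator smul A" and "closed A" and "\<alpha> > 0"
  shows "closed (tikhonov A \<alpha>)"
  unfolding closed_sequential_limits
proof (intro allI impI, elim conjE)
  fix x l
  assume mem: "\<forall>n. x n \<in> tikhonov A \<alpha>" and lim: "x \<longlonglongrightarrow> l"
  obtain u' where u': "(fst l, u') \<in> tikhonov A \<alpha>"
    using Domain_tikhonov[OF assms] by blast
  have "(\<lambda>n. snd (x n)) \<longlonglongrightarrow> u'"
    by (rule tikhonov_tendsto[OF lin \<open>\<alpha> > 0\<close> _ u' tendsto_fst[OF lim]]) (simp add: mem)
  then have "snd l = u'"
    using tendsto_snd[OF lim] LIMSEQ_unique by blast
  then show "l \<in> tikhonov A \<alpha>"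
    using u' by (metis prod.collapse)
qed

section \<open>Density of the adjoint domain and the link with the resolvent\<close>

text \<open>For \<open>p\<close> orthogonal to the adjoint domain, the problem is solved with datum
  \<open>p\<close> and parameter 1. Orthogonality of \<open>p\<close> to \<open>p - z\<close>,
  combined with the energy identity, forces \<open>u\<close>, then \<open>z\<close>, then
  \<open>p\<close> to vanish.\<close>

lemma densely_defined_op_adjoint:
  assumes lin: "linear_operator smul A" and "closed A"
  shows "densely_defined (op_adjoint ip A)"
  unfolding densely_defined_def
proof (rule dense_if_orthogonal_zero)
  show "Real_Vector_Spaces.subspace (Domain (op_adjoint ip A))"
    unfolding fst_eq_Domain[symmetric]
    by (intro linear_subspace_image linear_fst op_adjoint_subspace)
  fix p
  assume orth: "\<And>y. y \<in> Domain (op_adjoint ip A) \<Longrightarrow> rip p y = 0"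
  obtain u z where uz: "(u, z) \<in> A" and adj: "(p - z, 1 *\<^sub>R u) \<in> op_adjoint ip A"
    using Domain_tikhonov[OF assms, of 1] by (fastforce simp: tikhonov_def)
  have energy: "rip z p = (norm z)\<^sup>2 + (norm u)\<^sup>2"
    using tikhonov_energy[OF lin uz adj] by simp
  have "rip p (p - z) = 0"
    using adj by (intro orth) blast
  then have eq: "(norm p)\<^sup>2 = rip z p"
    by (simp add: rip_diff_right rip_self rip_commute)
  \<comment> \<open>By \<open>eq\<close> and \<open>energy\<close> this square equals minus the
    squared norm of \<open>u\<close>.\<close>
  have "0 \<le> rip (p - z) (p - z)"
    by (simp add: rip_self)
  also have "\<dots> = (norm p)\<^sup>2 - 2 * rip z p + (norm z)\<^sup>2"
    unfolding rip_diff_right rip_diff_left by (simp add: rip_self rip_commute[of p z])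
  finally have "(norm u)\<^sup>2 \<le> 0"
    using eq energy by simp
  then have "u = 0"
    by simp
  then have "z = 0"
    using lin uz by (auto simp: linear_operator_def dest: single_valuedD)
  then show "p = 0"
    using eq energy \<open>u = 0\<close> by simp
qed

text \<open>Subtracting a pair from \<open>(f, w)\<close> within the adjoint, a subspace, exchanges
  the condition at \<open>z\<close> with the one at \<open>f - z\<close>.\<close>

lemma op_shift_iff_tikhonov:
  assumes "(f, w) \<in> op_adjoint ip A"
  shows "(u, w) \<in> op_shift (A O op_adjoint ip A) \<alpha>
    \<longleftrightarrow> (\<exists>z. (u, z) \<in> A \<and> (f - z, \<alpha> *\<^sub>R u) \<in> op_adjoint ip A)"
proof -
  have "(z, w - \<alpha> *\<^sub>R u) \<in> op_adjoint ip A \<longleftrightarrow> (f - z, \<alpha> *\<^sub>R u) \<in> op_adjoint ip A" for z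
    using real_vector.subspace_diff[OF op_adjoint_subspace assms, of "(z, w - \<alpha> *\<^sub>R u)"]
      real_vector.subspace_diff[OF op_adjoint_subspace assms, of "(f - z, \<alpha> *\<^sub>R u)"] by auto
  moreover have "(u, w) \<in> op_shift (A O op_adjoint ip A) \<alpha>
      \<longleftrightarrow> (\<exists>z. (u, z) \<in> A \<and> (z, w - \<alpha> *\<^sub>R u) \<in> op_adjoint ip A)"
    by (force simp: op_shift_def relcomp_unfold)
  ultimately show ?thesis
    by simp
qed

lemma adjoint_resolvent_iff:
  "(f, u) \<in> op_adjoint ip A O (op_shift (A O op_adjoint ip A) \<alpha>)\<inverse>
    \<longleftrightarrow> f \<in> Domain (op_adjoint ip A) \<and> (f, u) \<in> tikhonov A \<alpha>"
  using op_shift_iff_tikhonov[of f _ A u \<alpha>]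
  by (auto simp: relcomp_unfold tikhonov_def)

end

theorem theorem1:
  fixes smul :: "'k::hilbert_scalar \<Rightarrow> 'a::banach \<Rightarrow> 'a"
    and ip :: "'a \<Rightarrow> 'a \<Rightarrow> 'k"
    and A T T\<^sub>\<alpha> S :: "('a \<times> 'a) set"
    and \<alpha> :: real
  assumes "hilbert_space smul ip"
    and "closed_operator smul A"
    and "densely_defined A"
    and "unbounded_operator A"
    and "\<alpha> > 0"
    and "T = A O op_adjoint ip A"
    and "T\<^sub>\<alpha> = op_shift T \<alpha>"
    and "S = op_adjoint ip A O T\<^sub>\<alpha>\<inverse>"
  shows "Domain S = Domain (op_adjoint ip A) \<and>
    (\<exists>S'. closed_operator smul S' \<and> S \<subseteq> S' \<and> Domain S' = UNIV \<and>
      (\<forall>R. closed_operator smul R \<and> S \<subseteq> R \<longrightarrow> R = S') \<and>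
      op_norm S' \<le> ereal (1 / (2 * sqrt \<alpha>)))"
proof -
  interpret hilbert_space smul ip
    by fact
  have lin: "linear_operator smul A" and "closed A"
    using assms(2) by (auto simp: closed_operator_def)
  define S' where "S' = tikhonov A \<alpha>"
  have S_iff: "(f, u) \<in> S \<longleftrightarrow> f \<in> Domain (op_adjoint ip A) \<and> (f, u) \<in> S'" for f u
    unfolding assms(6-8) S'_def by (rule adjoint_resolvent_iff)
  have total: "Domain S' = UNIV"
    unfolding S'_def using lin \<open>closed A\<close> \<open>\<alpha> > 0\<close> by (rule Domain_tikhonov)
  have "Domain S = Domain (op_adjoint ip A)"
    using S_iff total by blast
  moreover have "closed_operator smul S'"
    unfolding closed_operator_def S'_def
    using linear_operator_tikhonov closed_tikhonov lin \<open>closed A\<close> \<open>\<alpha> > 0\<close> by blast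
  moreover have "S \<subseteq> S'"
    using S_iff by auto
  \<comment> \<open>Density and continuity give \<open>S' \<subseteq> R\<close> by passing to limits
    in the closed set \<open>R\<close>. Equality follows because a single-valued relation cannot
    properly extend a total one.\<close>
  moreover have "R = S'" if R: "closed_operator smul R" "S \<subseteq> R" for R
  proof -
    have "S' \<subseteq> R"
    proof (rule subrelI)
      fix f u
      assume fu: "(f, u) \<in> S'"
      have "f \<in> closure (Domain (op_adjoint ip A))"
        using densely_defined_op_adjoint[OF lin \<open>closed A\<close>] by (simp add: densely_defined_def)
      then obtain g where g: "\<And>n. g n \<in> Domain (op_adjoint ip A)" "g \<longlonglongrightarrow> f"
        unfolding closure_sequential by blast
      have "\<exists>v. (g n, v) \<in> S'" for n
        using total by blast
      then obtain v where v: "\<And>n. (g n, v n) \<in> S'"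
        by metis
      then have "v \<longlonglongrightarrow> u"
        using fu g(2) unfolding S'_def by (rule tikhonov_tendsto[OF lin \<open>\<alpha> > 0\<close>])
      then have "(\<lambda>n. (g n, v n)) \<longlonglongrightarrow> (f, u)"
        using g(2) by (intro tendsto_Pair)
      moreover have "(g n, v n) \<in> R" for n
        using S_iff g(1) v R(2) by blast
      ultimately show "(f, u) \<in> R"
        using R(1) closed_sequentially[of R "\<lambda>n. (g n, v n)"] by (auto simp: closed_operator_def)
    qed
    moreover have "R \<subseteq> S'"
    proof (rule subrelI)
      fix f u
      assume "(f, u) \<in> R"
      obtain v where "(f, v) \<in> S'"
        using total by blast
      moreover have "single_valued R"
        using R(1) by (simp add: closed_operator_def linear_operator_def)
      ultimately have "u = v"
        using \<open>S' \<subseteq> R\<close> \<open>(f, u) \<in> R\<close> by (blast dest: single_valuedD)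
      then show "(f, u) \<in> S'"
        using \<open>(f, v) \<in> S'\<close> by simp
    qed
    ultimately show ?thesis
      by blast
  qed
  moreover have "op_norm S' \<le> ereal (1 / (2 * sqrt \<alpha>))"
    unfolding op_norm_def
  proof (rule SUP_least, clarify)
    fix f u
    assume "(f, u) \<in> S'" "norm f \<le> 1"
    then have "norm u \<le> norm f / (2 * sqrt \<alpha>)"
      unfolding S'_def by (intro tikhonov_bound[OF lin \<open>\<alpha> > 0\<close>])
    also have "\<dots> \<le> 1 / (2 * sqrt \<alpha>)"
      using \<open>norm f \<le> 1\<close> \<open>\<alpha> > 0\<close> by (intro divide_right_mono) auto
    finally show "ereal (norm u) \<le> ereal (1 / (2 * sqrt \<alpha>))"
      by simp
  qed
  ultimately show ?thesis
    using total by blast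
qed

end
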